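(* Let $G$ be a finite connected unicyclic metric graph with edge lengths $\ell\in(0,\infty)^E$. Assume that every degree-one vertex is an exterior boundary vertex, every internal vertex carries the Kirchhoff condition, and each exterior vertex carries either Dirichlet or Neumann boundary conditions. If $r$ is the edge-energy vector of any regular secular state on $G$, then $$r\in\mathcal M_G^{\mathrm{bc}}.$$ In fact, $r$ admits a finite decomposition $$r=\sum_{j\in J_+}\bigl(A_+^{(j)}\bigr)^{\circ2}+\sum_{j\in J_-}\bigl(A_-^{(j)}\bigr)^{\circ2},$$ where $A_+^{(j)}\in\ker B_+$ and $A_-^{(j)}\in\ker B_-$ are real vectors. Consequently, for every $\alpha\in[0,\infty)^E$, $$\frac{\alpha\cdot r}{\ell\cdot r}\ge C_{\mathrm{sing}}(\alpha;\ell).$$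
   Context: **Graphs.** $G=(V,E)$ is finite (a loop or a pair of parallel edges may form the cycle). Its vertices are split into internal vertices $V_{\mathrm{int}}$ (degree at least two, standard Kirchhoff condition) and exterior vertices (exactly the degree-one vertices). Unicyclic: exactly one independent cycle. Every edge has at least one internal endpoint. Orient the edges, terminal edges from the internal to the exterior endpoint. **Singular cone.** A boundary-compatible singular sector $\sigma$ consists of: a parity $\sigma_e=\cos\theta_e\in\{\pm1\}$, $\theta_e\in\pi\mathbb Z$, for each internal--internal edge; a phase class $\theta_e\in\pi\mathbb Z$ for each internal--Dirichlet edge; a phase class $\theta_e\in\frac\pi2+\pi\mathbb Z$ for each internal--Neumann edge. $B_{\sigma,\mathrm{bc}}\in\mathbb R^{V_{\mathrm{int}}\times E}$ has: for a non-loop internal--internal edge from $v_-$ to $v_+$, entries $1$ in row $v_-$ and $-\sigma_e$ in row $v_+$; for a loop at $v$, entry $1-\sigma_e$ in row $v$; for a terminal edge at internal vertex $v$, entry $1$ in row $v$; all other entries zero. With $A^{\circ2}=(A_e^2)_e$, $\mathcal M_G^{\mathrm{bc}}$ is the convex cone generated by $\bigcup_\sigma\{A^{\circ2}:A\in\ker B_{\sigma,\mathrm{bc}}\}$. $$C_{\mathrm{sing}}(\alpha;\ell)=\min_\sigma\ \inf_{0\ne A\in\ker B_{\sigma,\mathrm{bc}}}\frac{\sum_e\alpha_eA_e^2}{\sum_e\ell_eA_e^2}$$ (sectors with trivial kernel omitted). **The two closure sectors.** Fix an edge $e_\circ$ of the unique cycle. $B_+$ and $B_-$ are the matrices $B_{\sigma,\mathrm{bc}}$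 with $\sigma_e=+1$ (ordinary oriented incidence) for all internal--internal edges $e\ne e_\circ$ and $\sigma_{e_\circ}=+1$, respectively $\sigma_{e_\circ}=-1$; up to multiplication on left and right by diagonal $\pm1$ matrices they represent the two sign classes of the cycle. **Regular secular states.** A regular secular state at a phase vector $\theta\in(\mathbb R/2\pi\mathbb Z)^E$ consists of real vertex values $\phi_v$ ($v\in V_{\mathrm{int}}$) and real normalized outward derivatives $p_{v,e}$, one for each incidence of an edge with an internal vertex (two for a loop), not all zero, such that: at each internal vertex the $p_{v,e}$ over all incidences sum to $0$; for each internal--internal edge $e=vw$, $\theta_e\notin\pi\mathbb Z$, $\phi_w=\phi_v\cos\theta_e+p_{v,e}\sin\theta_e$ and $-p_{w,e}=-\phi_v\sin\theta_e+p_{v,e}\cos\theta_e$; for each terminal edge at $v$, $\phi_v\cos\theta_e+p_{v,e}\sin\theta_e=0$ (Dirichlet) or $-\phi_v\sin\theta_e+p_{v,e}\cos\theta_e=0$ (Neumann). Its edge-energy vector is $r_e=\phi_v^2+p_{v,e}^2$ (the same at both internal endpoints); it equals $|A_e|^2+|B_e|^2$ for $u_e(x)=A_e\cos kx+B_e\sin kx$, $k\ell_e\equiv\theta_e$. *)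

theory Defs
  imports "HOL-Analysis.Analysis" "Graph_Theory.Digraph_Component"
begin

text \<open>
  A finite multigraph with a chosen orientation is a \<^typ>\<open>('v, 'e) pre_digraph\<close>; loops and parallel
  arcs are allowed. The edge set is the whole type \<open>'e\<close>, so that edge-indexed vectors live in
  \<open>real ^ 'e\<close>, while the vertex set is a carrier set.
\<close>

section \<open>Graphs\<close>

text \<open>A loop contributes two to the degree.\<close>

definition degree :: "('v, 'e) pre_digraph \<Rightarrow> 'v \<Rightarrow> nat" where
  "degree G v = in_degree G v + out_degree G v"

definition internal_verts :: "('v, 'e) pre_digraph \<Rightarrow> 'v set" where
  "internal_verts G = {v \<in> verts G. degree G v \<ge> 2}"

definition exterior_verts :: "('v, 'e) pre_digraph \<Rightarrow> 'v set" where
  "exterior_verts G = {v \<in> verts G. degree G v = 1}"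

definition internal_edge :: "('v, 'e) pre_digraph \<Rightarrow> 'e \<Rightarrow> bool" where
  "internal_edge G e \<longleftrightarrow> tail G e \<in> internal_verts G \<and> head G e \<in> internal_verts G"

text \<open>Terminal edges are oriented from the internal to the exterior endpoint.\<close>

definition terminal_edge :: "('v, 'e) pre_digraph \<Rightarrow> 'e \<Rightarrow> bool" where
  "terminal_edge G e \<longleftrightarrow> tail G e \<in> internal_verts G \<and> head G e \<in> exterior_verts G"

text \<open>The real cycle space (first homology) of the graph; its dimension is the number of
  independent cycles.\<close>

definition cycle_space :: "('v, 'e::finite) pre_digraph \<Rightarrow> (real ^ 'e) set" where
  "cycle_space G =
    {z. \<forall>v \<in> verts G. (\<Sum>e \<in> out_arcs G v. z $ e) = (\<Sum>e \<in> in_arcs G v. z $ e)}"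

definition unicyclic :: "('v, 'e::finite) pre_digraph \<Rightarrow> bool" where
  "unicyclic G \<longleftrightarrow> dim (cycle_space G) = 1"

text \<open>Every edge taken in both directions. The cycles of the undirected multigraph are the
  directed cycles here that use no edge twice; without the latter condition, going back and forth
  along an edge would count. A loop is a cycle of length one, a pair of parallel edges one of
  length two.\<close>

definition both_directions :: "('v, 'e) pre_digraph \<Rightarrow> ('v, 'e \<times> bool) pre_digraph" where
  "both_directions G =
    \<lparr> verts = verts G, arcs = arcs G \<times> UNIV,
      tail = (\<lambda>(e, forward). if forward then tail G e else head G e),
      head = (\<lambda>(e, forward). if forward then head G e else tail G e) \<rparr>"

definition undirected_cycle :: "('v, 'e) pre_digraph \<Rightarrow> ('e \<times> bool) list \<Rightarrow> bool" where
  "undirected_cycle G c \<longleftrightarrow> pre_digraph.cycle (both_directions G) c \<and> distinct (map fst c)"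

definition cycle_edge :: "('v, 'e) pre_digraph \<Rightarrow> 'e \<Rightarrow> bool" where
  "cycle_edge G e \<longleftrightarrow> (\<exists>c. undirected_cycle G c \<and> e \<in> fst ` set c)"

datatype boundary_condition = Dirichlet | Neumann

section \<open>The singular cone\<close>

text \<open>A sector is given by representative real phases; it enters the matrix below only through
  the parities \<open>cos (\<theta> e)\<close> of the internal--internal edges.\<close>

definition singular_sector ::
    "('v, 'e) pre_digraph \<Rightarrow> ('v \<Rightarrow> boundary_condition) \<Rightarrow> ('e \<Rightarrow> real) \<Rightarrow> bool" where
  "singular_sector G bc \<theta> \<longleftrightarrow>
    (\<forall>e \<in> arcs G.
      (internal_edge G e \<longrightarrow> (\<exists>n::int. \<theta> e = pi * of_int n)) \<and>
      (terminal_edge G e \<and> bc (head G e) = Dirichlet \<longrightarrow> (\<exists>n::int. \<theta> e = pi * of_int n)) \<and>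
      (terminal_edge G e \<and> bc (head G e) = Neumann \<longrightarrow> (\<exists>n::int. \<theta> e = pi / 2 + pi * of_int n)))"

definition parity :: "('e \<Rightarrow> real) \<Rightarrow> 'e \<Rightarrow> real" where
  "parity \<theta> e = cos (\<theta> e)"

text \<open>Only the rows \<open>v \<in> internal_verts G\<close> are rows of the matrix.\<close>

definition bc_matrix :: "('v, 'e) pre_digraph \<Rightarrow> ('e \<Rightarrow> real) \<Rightarrow> 'v \<Rightarrow> 'e \<Rightarrow> real" where
  "bc_matrix G \<sigma> v e =
    (if internal_edge G e \<and> tail G e \<noteq> head G e then
       (if v = tail G e then 1 else if v = head G e then - \<sigma> e else 0)
     else if internal_edge G e then
       (if v = tail G e then 1 - \<sigma> e else 0)
     else if terminal_edge G e then
       (if v = tail G e then 1 else 0)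
     else 0)"

definition bc_kernel :: "('v, 'e::finite) pre_digraph \<Rightarrow> ('e \<Rightarrow> real) \<Rightarrow> (real ^ 'e) set" where
  "bc_kernel G \<sigma> = {A. \<forall>v \<in> internal_verts G. (\<Sum>e \<in> UNIV. bc_matrix G \<sigma> v e * A $ e) = 0}"

definition hadamard_square :: "real ^ 'e \<Rightarrow> real ^ 'e" where
  "hadamard_square A = (\<chi> e. (A $ e)\<^sup>2)"

definition singular_cone ::
    "('v, 'e::finite) pre_digraph \<Rightarrow> ('v \<Rightarrow> boundary_condition) \<Rightarrow> (real ^ 'e) set" where
  "singular_cone G bc =
    convex_cone hull (\<Union>\<theta> \<in> {\<theta>. singular_sector G bc \<theta>}.
      hadamard_square ` bc_kernel G (parity \<theta>))"

definition sector_value ::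
    "('v, 'e::finite) pre_digraph \<Rightarrow> real ^ 'e \<Rightarrow> real ^ 'e \<Rightarrow> ('e \<Rightarrow> real) \<Rightarrow> real" where
  "sector_value G \<alpha> len \<sigma> =
    (INF A \<in> bc_kernel G \<sigma> - {0}.
      (\<Sum>e \<in> UNIV. \<alpha> $ e * (A $ e)\<^sup>2) / (\<Sum>e \<in> UNIV. len $ e * (A $ e)\<^sup>2))"

text \<open>Infinitely many \<open>\<theta>\<close> represent sectors, but they yield finitely many parities, so the set
  whose minimum is taken is finite.\<close>

definition C_sing :: "('v, 'e::finite) pre_digraph \<Rightarrow> ('v \<Rightarrow> boundary_condition) \<Rightarrow>
    real ^ 'e \<Rightarrow> real ^ 'e \<Rightarrow> real" where
  "C_sing G bc \<alpha> len =
    Min ((\<lambda>\<theta>. sector_value G \<alpha> len (parity \<theta>)) `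
      {\<theta>. singular_sector G bc \<theta> \<and> bc_kernel G (parity \<theta>) \<noteq> {0}})"

text \<open>The kernels of \<open>B\<^sub>+\<close> (for \<open>s = 1\<close>) and \<open>B\<^sub>-\<close> (for \<open>s = -1\<close>) with closing edge \<open>e\<^sub>0\<close>.\<close>

definition closure_kernel ::
    "('v, 'e::finite) pre_digraph \<Rightarrow> 'e \<Rightarrow> real \<Rightarrow> (real ^ 'e) set" where
  "closure_kernel G e\<^sub>0 s = bc_kernel G (\<lambda>e. if e = e\<^sub>0 then s else 1)"

section \<open>Regular secular states\<close>

text \<open>The normalized outward derivatives are \<open>p e\<close> at the tail incidence and \<open>q e\<close> at the head
  incidence of \<open>e\<close>; the values \<open>q e\<close> of terminal edges and \<open>\<phi> v\<close> of exterior vertices are not part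
  of the state and are never used. Phases are real representatives; all conditions are
  \<open>2\<pi>\<close>-periodic in each phase.\<close>

definition regular_secular_state ::
    "('v, 'e) pre_digraph \<Rightarrow> ('v \<Rightarrow> boundary_condition) \<Rightarrow> ('e \<Rightarrow> real) \<Rightarrow>
      ('v \<Rightarrow> real) \<Rightarrow> ('e \<Rightarrow> real) \<Rightarrow> ('e \<Rightarrow> real) \<Rightarrow> bool" where
  "regular_secular_state G bc \<theta> \<phi> p q \<longleftrightarrow>
    ((\<exists>v \<in> internal_verts G. \<phi> v \<noteq> 0) \<or>
     (\<exists>e \<in> arcs G. tail G e \<in> internal_verts G \<and> p e \<noteq> 0) \<or>
     (\<exists>e \<in> arcs G. head G e \<in> internal_verts G \<and> q e \<noteq> 0)) \<and>
    (\<forall>v \<in> internal_verts G. (\<Sum>e \<in> out_arcs G v. p e) + (\<Sum>e \<in> in_arcs G v. q e) = 0) \<and>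
    (\<forall>e \<in> arcs G. internal_edge G e \<longrightarrow>
      (\<nexists>n::int. \<theta> e = pi * of_int n) \<and>
      \<phi> (head G e) = \<phi> (tail G e) * cos (\<theta> e) + p e * sin (\<theta> e) \<and>
      - q e = - \<phi> (tail G e) * sin (\<theta> e) + p e * cos (\<theta> e)) \<and>
    (\<forall>e \<in> arcs G. terminal_edge G e \<and> bc (head G e) = Dirichlet \<longrightarrow>
      \<phi> (tail G e) * cos (\<theta> e) + p e * sin (\<theta> e) = 0) \<and>
    (\<forall>e \<in> arcs G. terminal_edge G e \<and> bc (head G e) = Neumann \<longrightarrow>
      - \<phi> (tail G e) * sin (\<theta> e) + p e * cos (\<theta> e) = 0)"

definition edge_energy ::
    "('v, 'e::finite) pre_digraph \<Rightarrow> ('v \<Rightarrow> real) \<Rightarrow> ('e \<Rightarrow> real) \<Rightarrow> real ^ 'e" where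
  "edge_energy G \<phi> p = (\<chi> e. (\<phi> (tail G e))\<^sup>2 + (p e)\<^sup>2)"

end

theory Submission
  imports Defs
begin

text \<open>
  The proof exhibits two vectors: \<open>r = A\<^sup>2 + B\<^sup>2\<close> with \<open>A \<in> ker B\<^sub>+\<close> and \<open>B \<in> ker B\<^sub>-\<close>,
  the real and the imaginary part of a complex flow whose modulus on every edge is \<open>\<surd>r\<close>.

  At an internal vertex \<open>v\<close> the incident edges carry the lengths \<open>\<surd>r\<^sub>e = \<bar>\<phi>\<^sub>v + \<i> p\<^sub>e\<bar>\<close>. Since the
  \<open>p\<^sub>e\<close> sum to zero and there are at least two incidences, none of these lengths exceeds the sum of
  the others, so they are the sides of a closed polygon in the complex plane
  (\<open>kirchhoff_polygon\<close>). This produces, at each incidence, a complex number of modulus \<open>\<surd>r\<^sub>e\<close>, with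
  sum zero at each vertex.

  The polygons of different vertices may be rotated independently. They fit together to a flow when
  the two numbers on each edge are opposite to each other. Along a forest this can be achieved; in
  the unicyclic graph it can be achieved on every edge but \<open>e\<^sub>0\<close>. The combinatorial content is
  linear: the rotation angles are needed up to prescribed differences along the edges, and the
  vectors of such differences form the orthogonal complement of the one-dimensional cycle space
  (\<open>potential_off_closing_edge\<close>).

  On \<open>e\<^sub>0\<close> two complex numbers of equal modulus remain. A common rotation of everything makes them
  negative conjugates of each other. The real parts are then opposite, as \<open>B\<^sub>+\<close> demands, while the
  imaginary parts are equal, as \<open>B\<^sub>-\<close> demands.

  Both kernels belong to singular sectors, which gives the membership in the cone. The bound on the
  quotient holds for each of the two squares and is additive, being linear once the denominator is
  cleared.
\<close>

section \<open>Polygons with prescribed side lengths\<close>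

text \<open>As the summand turns around the origin, the modulus of the sum varies continuously between
  the two extremes that the triangle inequality permits.\<close>

lemma summand_with_prescribed_norms:
  fixes X :: complex
  assumes "\<bar>cmod X - l\<bar> \<le> t" and "t \<le> cmod X + l" and "0 \<le> l"
  shows "\<exists>y. cmod y = l \<and> cmod (X + y) = t"
proof -
  define f where "f \<tau> = cmod (X + of_real l * cis (Arg X + \<tau>))" for \<tau>
  have X: "X = of_real (cmod X) * cis (Arg X)"
    by (metis rcis_cmod_Arg rcis_def)
  have "X + of_real l * cis (Arg X + 0) = of_real (cmod X + l) * cis (Arg X)"
    using X by (simp add: algebra_simps)
  then have f0: "f 0 = cmod X + l"
    using assms(3) unfolding f_def by (simp only: norm_mult norm_of_real norm_cis) simp
  have "X + of_real l * cis (Arg X + pi) = of_real (cmod X - l) * cis (Arg X)"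
    using X by (simp add: algebra_simps flip: cis_mult)
  then have fpi: "f pi = \<bar>cmod X - l\<bar>"
    unfolding f_def by (simp only: norm_mult norm_of_real norm_cis) simp
  have "continuous_on {0..pi} f"
    unfolding f_def by (intro continuous_intros)
  then obtain \<tau> where "f \<tau> = t"
    using IVT2'[of f pi t 0] f0 fpi assms by auto
  then show ?thesis
    using assms(3) unfolding f_def
    by (intro exI[of _ "of_real l * cis (Arg X + \<tau>)"]) (simp add: norm_mult)
qed

text \<open>The polygon inequalities with one free side of length \<open>t\<close>. Allowing an arbitrary \<open>t\<close> is what
  makes the induction possible: the sides in \<open>I\<close> are first summed to a vector of suitable length,
  to which the new side is attached by a triangle.\<close>

lemma polygon_with_prescribed_lengths:
  fixes l :: "'i \<Rightarrow> real"
  assumes "finite I" and "\<And>i. i \<in> I \<Longrightarrow> 0 \<le> l i" and "0 \<le> t" and "t \<le> sum l I"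
    and "\<And>i. i \<in> I \<Longrightarrow> l i \<le> t + sum l (I - {i})"
  shows "\<exists>x. (\<forall>i\<in>I. cmod (x i) = l i) \<and> cmod (sum x I) = t"
  using assms
proof (induction I arbitrary: t rule: finite_induct)
  case empty
  then show ?case by auto
next
  case (insert a I)
  have la: "0 \<le> l a" using insert.prems(1) by simp
  \<comment> \<open>The largest length that both the sides in \<open>I\<close> and a triangle with sides \<open>l a\<close> and \<open>t\<close> allow.\<close>
  define s where "s = min (l a + t) (sum l I)"
  have nonneg: "0 \<le> sum l I" by (intro sum_nonneg) (use insert.prems(1) in auto)
  have a: "l a \<le> t + sum l I"
    using insert.prems(4)[of a] insert.hyps by simp
  have t: "t \<le> l a + sum l I" using insert.prems(3) insert.hyps by simp
  have side: "l i \<le> s + sum l (I - {i})" if i: "i \<in> I" for i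
  proof -
    have "insert a I - {i} = insert a (I - {i})" using i insert.hyps by auto
    then have "l i \<le> t + (l a + sum l (I - {i}))"
      using insert.prems(4)[of i] i insert.hyps by simp
    moreover have "l i \<le> sum l I + sum l (I - {i})"
      using member_le_sum[of i I l] i insert.hyps insert.prems(1)
        sum_nonneg[of "I - {i}" l] by force
    ultimately show ?thesis unfolding s_def by auto
  qed
  have "\<exists>x. (\<forall>i\<in>I. cmod (x i) = l i) \<and> cmod (sum x I) = s"
    by (rule insert.IH) (use insert.prems side nonneg la in \<open>auto simp: s_def\<close>)
  then obtain x where x: "\<forall>i\<in>I. cmod (x i) = l i" "cmod (sum x I) = s" by blast
  have "\<bar>cmod (sum x I) - l a\<bar> \<le> t" "t \<le> cmod (sum x I) + l a"
    using x(2) a t la insert.prems(2) nonneg by (auto simp: s_def min_def)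
  then obtain y where y: "cmod y = l a" "cmod (sum x I + y) = t"
    using summand_with_prescribed_norms la by blast
  have "sum (x(a := y)) I = sum x I"
    using insert.hyps by (intro sum.cong) auto
  then show ?case
    using x y insert.hyps by (intro exI[of _ "x(a := y)"]) (auto simp: add.commute)
qed

text \<open>The sides other than \<open>i\<close> may be replaced by the vectors \<open>\<bar>\<phi>\<bar> + \<i> m\<^sub>j\<close>. Their sum has imaginary
  part \<open>- m\<^sub>i\<close> and, as there is at least one of them, real part at least \<open>\<bar>\<phi>\<bar>\<close>; so it is at least as
  long as side \<open>i\<close>.\<close>

lemma kirchhoff_polygon:
  fixes m :: "'i \<Rightarrow> real"
  assumes fin: "finite I" and card: "card I \<ge> 2" and zero: "sum m I = 0"
  shows "\<exists>x. (\<forall>i\<in>I. cmod (x i) = cmod (Complex \<phi> (m i))) \<and> sum x I = 0"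
proof -
  have side: "cmod (Complex \<phi> (m i)) \<le> 0 + (\<Sum>j\<in>I - {i}. cmod (Complex \<phi> (m j)))" if i: "i \<in> I" for i
  proof -
    let ?k = "card (I - {i})"
    have k: "1 \<le> real ?k" using fin card i by simp
    have m: "sum m (I - {i}) = - m i" using zero sum.remove[OF fin i, of m] by simp
    have "cmod (Complex \<phi> (m i)) \<le> cmod (Complex (real ?k * \<bar>\<phi>\<bar>) (- m i))"
      using mult_right_mono[OF k, of "\<bar>\<phi>\<bar>"]
      by (auto simp: cmod_def abs_le_square_iff[symmetric] abs_mult)
    also have "Complex (real ?k * \<bar>\<phi>\<bar>) (- m i) = (\<Sum>j\<in>I - {i}. Complex \<bar>\<phi>\<bar> (m j))"
      using m by (simp add: complex_eq_iff)
    also have "cmod \<dots> \<le> (\<Sum>j\<in>I - {i}. cmod (Complex \<bar>\<phi>\<bar> (m j)))"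
      by (rule norm_sum)
    also have "\<dots> = (\<Sum>j\<in>I - {i}. cmod (Complex \<phi> (m j)))"
      by (simp add: cmod_def)
    finally show ?thesis by simp
  qed
  have "\<exists>x. (\<forall>i\<in>I. cmod (x i) = cmod (Complex \<phi> (m i))) \<and> cmod (sum x I) = 0"
    by (rule polygon_with_prescribed_lengths[OF fin _ _ _ side]) (auto intro: sum_nonneg)
  then show ?thesis by simp
qed

section \<open>Potentials and the cycle space\<close>

definition coboundary :: "('v, 'e::finite) pre_digraph \<Rightarrow> ('v \<Rightarrow> real) \<Rightarrow> real ^ 'e" where
  "coboundary G a = (\<chi> e. a (head G e) - a (tail G e))"

text \<open>Pairing a vector with the coboundary of the indicator of a vertex \<open>v\<close> gives its net inflow
  at \<open>v\<close>.\<close>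

lemma cycle_space_iff_orthogonal_coboundary:
  assumes "arcs G = UNIV"
  shows "z \<in> cycle_space G \<longleftrightarrow> (\<forall>v\<in>verts G. z \<bullet> coboundary G (indicator {v}) = 0)"
proof -
  have "z \<bullet> coboundary G (indicator {v}) =
    (\<Sum>e\<in>in_arcs G v. z $ e) - (\<Sum>e\<in>out_arcs G v. z $ e)" for v
  proof -
    have "z \<bullet> coboundary G (indicator {v}) =
      (\<Sum>e\<in>UNIV. (if head G e = v then z $ e else 0) - (if tail G e = v then z $ e else 0))"
      unfolding inner_vec_def coboundary_def by (intro sum.cong) (auto simp: indicator_def)
    then show ?thesis
      using assms by (simp add: sum_subtractf sum.If_cases in_arcs_def out_arcs_def)
  qed
  then show ?thesis unfolding cycle_space_def by auto
qed

text \<open>Prescribed differences \<open>w\<close> are attained iff \<open>w\<close> is orthogonal to the cycle space, here the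
  line through \<open>z\<close>. As \<open>z\<close> does not vanish on \<open>e\<^sub>0\<close>, the orthogonality can be enforced by changing
  \<open>w\<close> on \<open>e\<^sub>0\<close> alone.\<close>

lemma potential_off_closing_edge:
  fixes G :: "('v, 'e::finite) pre_digraph" and w :: "'e \<Rightarrow> real"
  assumes arcs: "arcs G = UNIV" and uni: "unicyclic G"
    and z: "z \<in> cycle_space G" and z0: "z $ e\<^sub>0 \<noteq> 0"
  shows "\<exists>a. \<forall>e. e \<noteq> e\<^sub>0 \<longrightarrow> a (head G e) - a (tail G e) = w e"
proof -
  let ?U = "range (coboundary G)"
  have "subspace ?U"
    unfolding subspace_def
  proof (intro conjI ballI allI)
    show "0 \<in> ?U" by (rule range_eqI[of _ _ "\<lambda>_. 0"]) (simp add: coboundary_def vec_eq_iff)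
  next
    fix x y assume "x \<in> ?U" "y \<in> ?U"
    then obtain a b where "x = coboundary G a" "y = coboundary G b" by auto
    then show "x + y \<in> ?U"
      by (intro range_eqI[of _ _ "\<lambda>v. a v + b v"]) (simp add: coboundary_def vec_eq_iff)
  next
    fix c x assume "x \<in> ?U"
    then obtain a where "x = coboundary G a" by auto
    then show "c *\<^sub>R x \<in> ?U"
      by (intro range_eqI[of _ _ "\<lambda>v. c * a v"]) (simp add: coboundary_def vec_eq_iff right_diff_distrib)
  qed
  then have U: "?U\<^sup>\<bottom>\<^sup>\<bottom> = ?U" by (rule orthogonal_comp_self)
  have line: "\<exists>k. y = k *\<^sub>R z" if "y \<in> cycle_space G" for y
  proof -
    have "z \<noteq> 0" using z0 by auto
    then have "dim {z} = 1" by (simp add: dim_eq_card_independent)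
    then have "span {z} = span (cycle_space G)"
      using uni z by (intro dim_eq_span) (auto simp: unicyclic_def)
    then have "y \<in> span {z}" using that span_base by auto
    then show ?thesis by (auto simp: span_singleton)
  qed
  define w' where "w' = (\<chi> e. w e) - ((z \<bullet> (\<chi> e. w e)) / z $ e\<^sub>0) *\<^sub>R axis e\<^sub>0 1"
  have w': "z \<bullet> w' = 0"
    using z0 by (simp add: w'_def inner_diff_right inner_axis)
  have "w' \<in> ?U\<^sup>\<bottom>\<^sup>\<bottom>"
    unfolding orthogonal_comp_def[of "?U\<^sup>\<bottom>"]
  proof clarify
    fix y assume "y \<in> ?U\<^sup>\<bottom>"
    then have "y \<in> cycle_space G"
      unfolding cycle_space_iff_orthogonal_coboundary[OF arcs] orthogonal_comp_def
      by (auto simp: orthogonal_def inner_commute)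
    then obtain k where "y = k *\<^sub>R z" using line by blast
    then show "orthogonal y w'" using w' by (simp add: orthogonal_def)
  qed
  then obtain a where a: "w' = coboundary G a" using U by auto
  have "a (head G e) - a (tail G e) = w e" if "e \<noteq> e\<^sub>0" for e
  proof -
    have "a (head G e) - a (tail G e) = w' $ e" using a by (simp add: coboundary_def)
    then show ?thesis using that by (simp add: w'_def axis_def)
  qed
  then show ?thesis by blast
qed

definition walk_flow :: "('e \<times> bool) list \<Rightarrow> real ^ 'e" where
  "walk_flow c = (\<chi> e. \<Sum>(f, forward)\<leftarrow>c. if f = e then if forward then 1 else - 1 else 0)"

text \<open>The differences of \<open>a\<close> telescope along a walk, so every closed walk gives an element of the
  cycle space.\<close>

lemma walk_flow_coboundary:
  "pre_digraph.cas (both_directions G) u c v \<Longrightarrow>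
    walk_flow c \<bullet> coboundary G a = a v - a u"
proof (induction c arbitrary: u)
  case Nil
  then show ?case by (simp add: pre_digraph.cas.simps walk_flow_def inner_vec_def)
next
  case (Cons s c)
  obtain e fw where s: "s = (e, fw)" by force
  have "walk_flow (s # c) = (if fw then 1 else - 1) *\<^sub>R axis e 1 + walk_flow c"
    by (auto simp: walk_flow_def vec_eq_iff axis_def s)
  moreover have "walk_flow c \<bullet> coboundary G a = a v - a (if fw then head G e else tail G e)"
    and "u = (if fw then tail G e else head G e)"
    using Cons by (auto simp: pre_digraph.cas.simps s both_directions_def)
  ultimately show ?case
    by (simp add: inner_add_left inner_axis' coboundary_def)
qed

lemma walk_flow_nonzero:
  "distinct (map fst c) \<Longrightarrow> e \<in> fst ` set c \<Longrightarrow> walk_flow c $ e \<noteq> 0"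
proof (induction c)
  case (Cons s c)
  obtain f fw where s: "s = (f, fw)" by force
  have "walk_flow c $ e = 0" if "e \<notin> fst ` set c"
    using that unfolding walk_flow_def by (induction c) auto
  then show ?case using Cons by (auto simp: walk_flow_def s)
qed simp

lemma cycle_edge_in_support:
  assumes "arcs G = UNIV" and "cycle_edge G e"
  shows "\<exists>z\<in>cycle_space G. z $ e \<noteq> 0"
proof -
  obtain c where c: "undirected_cycle G c" "e \<in> fst ` set c"
    using assms(2) unfolding cycle_edge_def by blast
  then obtain u where "pre_digraph.cas (both_directions G) u c u"
    unfolding undirected_cycle_def pre_digraph.cycle_def pre_digraph.awalk_def by blast
  then have "walk_flow c \<in> cycle_space G"
    by (simp add: cycle_space_iff_orthogonal_coboundary[OF assms(1)] walk_flow_coboundary)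
  then show ?thesis
    using walk_flow_nonzero c unfolding undirected_cycle_def by blast
qed

section \<open>The complex flow of a regular secular state\<close>

lemma head_internal_imp_internal_edge:
  assumes "internal_edge G e \<or> terminal_edge G e" and "head G e \<in> internal_verts G"
  shows "internal_edge G e"
  using assms by (auto simp: terminal_edge_def internal_verts_def exterior_verts_def)

lemma bc_matrix_row:
  fixes A :: "real ^ 'e::finite"
  assumes arcs: "arcs G = UNIV"
    and edges: "\<And>e. internal_edge G e \<or> terminal_edge G e"
    and v: "v \<in> internal_verts G"
  shows "(\<Sum>e\<in>UNIV. bc_matrix G \<sigma> v e * A $ e) =
    (\<Sum>e\<in>out_arcs G v. A $ e) - (\<Sum>e\<in>in_arcs G v. \<sigma> e * A $ e)"
proof -
  have "bc_matrix G \<sigma> v e * A $ e =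
    (if tail G e = v then A $ e else 0) - (if head G e = v then \<sigma> e * A $ e else 0)" for e
  proof (cases "internal_edge G e")
    case True
    then show ?thesis by (auto simp: bc_matrix_def left_diff_distrib)
  next
    case False
    then have "terminal_edge G e" "head G e \<noteq> v"
      using edges[of e] head_internal_imp_internal_edge[OF edges] v by blast+
    with False show ?thesis by (simp add: bc_matrix_def)
  qed
  then show ?thesis
    using arcs by (simp add: sum_subtractf sum.If_cases in_arcs_def out_arcs_def)
qed

lemma bc_kernel_cong:
  assumes "\<And>e. internal_edge G e \<Longrightarrow> \<sigma> e = \<sigma>' e"
  shows "bc_kernel G \<sigma> = bc_kernel G \<sigma>'"
proof -
  have "bc_matrix G \<sigma> = bc_matrix G \<sigma>'"
    using assms by (auto simp: bc_matrix_def fun_eq_iff)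
  then show ?thesis by (simp add: bc_kernel_def)
qed

text \<open>Along an internal edge the pair of value and derivative is rotated by the phase.\<close>

lemma head_energy:
  assumes "regular_secular_state G bc \<theta> \<phi> p q" and "arcs G = UNIV" and "internal_edge G e"
  shows "cmod (Complex (\<phi> (head G e)) (q e)) = cmod (Complex (\<phi> (tail G e)) (p e))"
proof -
  have h: "\<phi> (head G e) = \<phi> (tail G e) * cos (\<theta> e) + p e * sin (\<theta> e)"
    and q: "q e = \<phi> (tail G e) * sin (\<theta> e) - p e * cos (\<theta> e)"
    using assms unfolding regular_secular_state_def by auto
  have "(\<phi> (head G e))\<^sup>2 + (q e)\<^sup>2 =
      ((\<phi> (tail G e))\<^sup>2 + (p e)\<^sup>2) * ((sin (\<theta> e))\<^sup>2 + (cos (\<theta> e))\<^sup>2)"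
    unfolding h q by algebra
  then show ?thesis by (simp add: cmod_def)
qed

lemma rotation_between_equal_norms:
  assumes "cmod x = cmod y"
  shows "\<exists>w. cis w * x = y"
proof -
  have x: "x = of_real (cmod x) * cis (Arg x)" and y: "y = of_real (cmod x) * cis (Arg y)"
    using assms by (metis rcis_cmod_Arg rcis_def)+
  have "cis (Arg y - Arg x) * x = of_real (cmod x) * (cis (Arg y - Arg x) * cis (Arg x))"
    by (subst x) (simp only: mult.left_commute)
  also have "\<dots> = y" by (subst y) (simp add: cis_mult)
  finally show ?thesis by blast
qed

lemma rotation_to_negative_conjugates:
  assumes "cmod x = cmod y"
  shows "\<exists>\<tau>. cis \<tau> * x = - cnj (cis \<tau> * y)"
proof -
  obtain w where w: "cis w * x = - cnj y"
    using rotation_between_equal_norms[of x "- cnj y"] assms by auto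
  \<comment> \<open>Rotating both numbers by \<open>\<tau>\<close> changes the angle from one to the negative conjugate of the
    other by \<open>- 2\<tau>\<close>, so half of the angle \<open>w\<close> removes it.\<close>
  have "cis (w / 2) * x = cis (- (w / 2)) * (cis w * x)"
    by (simp add: cis_mult flip: mult.assoc)
  also have "\<dots> = - cnj (cis (w / 2) * y)"
    unfolding w by (simp add: cis_cnj)
  finally show ?thesis by blast
qed

text \<open>Every edge carries two complex numbers of the same modulus, \<open>t e\<close> at its tail and \<open>h e\<close> at its
  head, subject to Kirchhoff's law. The reflection in the last condition takes the place of the sign
  change on the edge that closes the cycle.\<close>

lemma complex_flow:
  fixes G :: "('v, 'e::finite) pre_digraph"
  assumes arcs: "arcs G = UNIV" and uni: "unicyclic G"
    and edges: "\<And>e. internal_edge G e \<or> terminal_edge G e"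
    and state: "regular_secular_state G bc \<theta> \<phi> p q"
    and z: "z \<in> cycle_space G" "z $ e\<^sub>0 \<noteq> 0"
  shows "\<exists>t h. (\<forall>e. cmod (t e) = cmod (Complex (\<phi> (tail G e)) (p e)))
    \<and> (\<forall>v\<in>internal_verts G. (\<Sum>e\<in>out_arcs G v. t e) + (\<Sum>e\<in>in_arcs G v. h e) = 0)
    \<and> (\<forall>e. internal_edge G e \<and> e \<noteq> e\<^sub>0 \<longrightarrow> h e = - t e)
    \<and> (internal_edge G e\<^sub>0 \<longrightarrow> h e\<^sub>0 = - cnj (t e\<^sub>0))"
proof -
  \<comment> \<open>The incidences at a vertex form a disjoint sum, since a loop occurs twice.\<close>
  define I where "I v = out_arcs G v <+> in_arcs G v" for v
  have polygon: "\<exists>x. (\<forall>i\<in>I v. cmod (x i) = cmod (Complex (\<phi> v) (case_sum p q i))) \<and> sum x (I v) = 0"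
    if v: "v \<in> internal_verts G" for v
  proof (rule kirchhoff_polygon)
    show "finite (I v)" by (simp add: I_def)
    show "card (I v) \<ge> 2"
      using v by (simp add: I_def card_Plus internal_verts_def degree_def in_degree_def out_degree_def)
    show "sum (case_sum p q) (I v) = 0"
      using v state by (simp add: I_def sum.Plus regular_secular_state_def o_def)
  qed
  then obtain x where norms: "\<And>v i. v \<in> internal_verts G \<Longrightarrow> i \<in> I v \<Longrightarrow>
        cmod (x v i) = cmod (Complex (\<phi> v) (case_sum p q i))"
      and closed: "\<And>v. v \<in> internal_verts G \<Longrightarrow> sum (x v) (I v) = 0"
    by metis
  define xt where "xt e = x (tail G e) (Inl e)" for e
  define xh where "xh e = x (head G e) (Inr e)" for e
  have tail_internal: "tail G e \<in> internal_verts G" for e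
    using edges[of e] by (auto simp: internal_edge_def terminal_edge_def)
  have xt: "cmod (xt e) = cmod (Complex (\<phi> (tail G e)) (p e))" for e
    using norms[OF tail_internal, of "Inl e" e] arcs by (auto simp: I_def xt_def Plus_def)
  have xh: "cmod (xh e) = cmod (xt e)" if "internal_edge G e" for e
    using norms[of "head G e" "Inr e"] head_energy[OF state arcs that] that arcs
    by (auto simp: I_def xh_def xt internal_edge_def Plus_def)
  have vertex: "(\<Sum>e\<in>out_arcs G v. xt e) + (\<Sum>e\<in>in_arcs G v. xh e) = 0"
    if "v \<in> internal_verts G" for v
  proof -
    have "(\<Sum>e\<in>out_arcs G v. xt e) = (\<Sum>e\<in>out_arcs G v. x v (Inl e))"
      by (intro sum.cong) (auto simp: xt_def)
    moreover have "(\<Sum>e\<in>in_arcs G v. xh e) = (\<Sum>e\<in>in_arcs G v. x v (Inr e))"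
      by (intro sum.cong) (auto simp: xh_def)
    ultimately show ?thesis
      using closed[OF that] by (simp add: I_def sum.Plus o_def)
  qed
  have "\<forall>e. \<exists>w. internal_edge G e \<longrightarrow> cis w * xh e = - xt e"
    using rotation_between_equal_norms xh by (metis norm_minus_cancel)
  then obtain w where w: "\<And>e. internal_edge G e \<Longrightarrow> cis (w e) * xh e = - xt e" by metis
  obtain a where a: "\<And>e. e \<noteq> e\<^sub>0 \<Longrightarrow> a (head G e) - a (tail G e) = w e"
    using potential_off_closing_edge[OF arcs uni z] by metis
  obtain \<tau> where \<tau>: "internal_edge G e\<^sub>0 \<Longrightarrow>
      cis \<tau> * (cis (a (head G e\<^sub>0)) * xh e\<^sub>0) = - cnj (cis \<tau> * (cis (a (tail G e\<^sub>0)) * xt e\<^sub>0))"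
    using rotation_to_negative_conjugates[of "cis (a (head G e\<^sub>0)) * xh e\<^sub>0"
        "cis (a (tail G e\<^sub>0)) * xt e\<^sub>0"] xh[of e\<^sub>0]
    by (metis norm_mult norm_cis mult_1)
  define t where "t e = cis \<tau> * (cis (a (tail G e)) * xt e)" for e
  define h where "h e = cis \<tau> * (cis (a (head G e)) * xh e)" for e
  have "cmod (t e) = cmod (Complex (\<phi> (tail G e)) (p e))" for e
    using xt by (simp add: t_def norm_mult)
  moreover have "(\<Sum>e\<in>out_arcs G v. t e) + (\<Sum>e\<in>in_arcs G v. h e) = 0"
    if v: "v \<in> internal_verts G" for v
  proof -
    have "(\<Sum>e\<in>out_arcs G v. t e) = cis \<tau> * cis (a v) * (\<Sum>e\<in>out_arcs G v. xt e)"
      unfolding sum_distrib_left by (intro sum.cong) (auto simp: t_def)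
    moreover have "(\<Sum>e\<in>in_arcs G v. h e) = cis \<tau> * cis (a v) * (\<Sum>e\<in>in_arcs G v. xh e)"
      unfolding sum_distrib_left by (intro sum.cong) (auto simp: h_def)
    ultimately show ?thesis
      using vertex[OF v] by (metis distrib_left mult_zero_right)
  qed
  moreover have "h e = - t e" if "internal_edge G e" "e \<noteq> e\<^sub>0" for e
  proof -
    have "cis (a (head G e)) = cis (a (tail G e)) * cis (w e)"
      by (simp add: cis_mult flip: a[OF that(2)])
    then show ?thesis using w[OF that(1)] by (simp add: h_def t_def mult.assoc)
  qed
  moreover have "internal_edge G e\<^sub>0 \<longrightarrow> h e\<^sub>0 = - cnj (t e\<^sub>0)"
    using \<tau> by (simp add: h_def t_def)
  ultimately show ?thesis by blast
qed

text \<open>On \<open>e\<^sub>0\<close> the conjugation leaves the real part alone and cancels the minus sign of the imaginary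
  part; this is why the parts of one flow lie in the kernels of opposite sign classes.\<close>

lemma edge_energy_decomposition:
  fixes G :: "('v, 'e::finite) pre_digraph"
  assumes arcs: "arcs G = UNIV" and uni: "unicyclic G"
    and edges: "\<And>e. internal_edge G e \<or> terminal_edge G e"
    and state: "regular_secular_state G bc \<theta> \<phi> p q"
    and z: "z \<in> cycle_space G" "z $ e\<^sub>0 \<noteq> 0"
  shows "\<exists>A\<in>closure_kernel G e\<^sub>0 1. \<exists>B\<in>closure_kernel G e\<^sub>0 (- 1).
    edge_energy G \<phi> p = hadamard_square A + hadamard_square B"
proof -
  obtain t h where t: "\<And>e. cmod (t e) = cmod (Complex (\<phi> (tail G e)) (p e))"
    and sum: "\<And>v. v \<in> internal_verts G \<Longrightarrow> (\<Sum>e\<in>out_arcs G v. t e) + (\<Sum>e\<in>in_arcs G v. h e) = 0"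
    and h: "\<And>e. internal_edge G e \<Longrightarrow> e \<noteq> e\<^sub>0 \<Longrightarrow> h e = - t e"
    and h0: "internal_edge G e\<^sub>0 \<Longrightarrow> h e\<^sub>0 = - cnj (t e\<^sub>0)"
    using complex_flow[OF arcs uni edges state z] by blast
  define A where "A = (\<chi> e. Re (t e))"
  define B where "B = (\<chi> e. Im (t e))"
  have inner_head: "internal_edge G e" if "v \<in> internal_verts G" "e \<in> in_arcs G v" for v e
    using that head_internal_imp_internal_edge[OF edges] by auto
  have re: "Re (h e) = - Re (t e)" if "internal_edge G e" for e
    using h h0 that by (cases "e = e\<^sub>0") auto
  have im: "Im (h e) = (if e = e\<^sub>0 then 1 else - 1) * Im (t e)" if "internal_edge G e" for e
    using h h0 that by (cases "e = e\<^sub>0") auto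
  have "A \<in> closure_kernel G e\<^sub>0 1"
    unfolding closure_kernel_def bc_kernel_def
  proof (intro CollectI ballI)
    fix v assume v: "v \<in> internal_verts G"
    have "(\<Sum>e\<in>in_arcs G v. (if e = e\<^sub>0 then 1 else 1) * A $ e) = - (\<Sum>e\<in>in_arcs G v. Re (h e))"
      unfolding sum_negf[symmetric] using re inner_head[OF v]
      by (intro sum.cong) (auto simp: A_def)
    then show "(\<Sum>e\<in>UNIV. bc_matrix G (\<lambda>e. if e = e\<^sub>0 then 1 else 1) v e * A $ e) = 0"
      unfolding bc_matrix_row[OF arcs edges v]
      using arg_cong[OF sum[OF v], of Re] by (simp add: A_def)
  qed
  moreover have "B \<in> closure_kernel G e\<^sub>0 (- 1)"
    unfolding closure_kernel_def bc_kernel_def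
  proof (intro CollectI ballI)
    fix v assume v: "v \<in> internal_verts G"
    have "(\<Sum>e\<in>in_arcs G v. (if e = e\<^sub>0 then - 1 else 1) * B $ e) = - (\<Sum>e\<in>in_arcs G v. Im (h e))"
      unfolding sum_negf[symmetric] using im inner_head[OF v]
      by (intro sum.cong) (auto simp: B_def)
    then show "(\<Sum>e\<in>UNIV. bc_matrix G (\<lambda>e. if e = e\<^sub>0 then - 1 else 1) v e * B $ e) = 0"
      unfolding bc_matrix_row[OF arcs edges v]
      using arg_cong[OF sum[OF v], of Im] by (simp add: B_def)
  qed
  moreover have "edge_energy G \<phi> p = hadamard_square A + hadamard_square B"
  proof -
    have "(\<phi> (tail G e))\<^sup>2 + (p e)\<^sup>2 = (Re (t e))\<^sup>2 + (Im (t e))\<^sup>2" for e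
      using t[of e] by (simp add: cmod_def)
    then show ?thesis
      by (simp add: edge_energy_def hadamard_square_def A_def B_def vec_eq_iff)
  qed
  ultimately show ?thesis by blast
qed

text \<open>The energy of an edge controls the state at both of its internal endpoints, and a nonzero
  vertex value is seen by any of the edges at that vertex. This keeps the denominator of the
  quotient positive.\<close>

lemma edge_energy_nonzero:
  fixes G :: "('v, 'e::finite) pre_digraph"
  assumes arcs: "arcs G = UNIV"
    and edges: "\<And>e. internal_edge G e \<or> terminal_edge G e"
    and state: "regular_secular_state G bc \<theta> \<phi> p q"
  shows "edge_energy G \<phi> p \<noteq> 0"
proof
  assume zero: "edge_energy G \<phi> p = 0"
  have tail0: "\<phi> (tail G e) = 0 \<and> p e = 0" for e
    using arg_cong[OF zero, of "\<lambda>x. x $ e"] by (simp add: edge_energy_def sum_power2_eq_zero_iff)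
  have head0: "\<phi> (head G e) = 0 \<and> q e = 0" if "head G e \<in> internal_verts G" for e
    using head_energy[OF state arcs head_internal_imp_internal_edge[OF edges that]] tail0[of e]
    by (simp add: cmod_def sum_power2_eq_zero_iff)
  have "\<phi> v = 0" if v: "v \<in> internal_verts G" for v
  proof -
    have "out_arcs G v \<noteq> {} \<or> in_arcs G v \<noteq> {}"
      using v by (auto simp: internal_verts_def degree_def in_degree_def out_degree_def)
    then show ?thesis using tail0 head0 v by fastforce
  qed
  then show False using state tail0 head0 unfolding regular_secular_state_def by blast
qed

section \<open>Sectors of the closure kernels and the quotient bound\<close>

lemma closure_kernel_sector:
  fixes G :: "('v, 'e::finite) pre_digraph"
  assumes "s = 1 \<or> s = - 1"
  shows "\<exists>\<theta>. singular_sector G bc \<theta> \<and> closure_kernel G e\<^sub>0 s = bc_kernel G (parity \<theta>)"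
proof -
  define \<theta> :: "'e \<Rightarrow> real" where
    "\<theta> e = (if internal_edge G e then if e = e\<^sub>0 \<and> s = - 1 then pi else 0
      else if bc (head G e) = Neumann then pi / 2 else 0)" for e
  have disjoint: "\<not> terminal_edge G e" if "internal_edge G e" for e
    using that by (auto simp: internal_edge_def terminal_edge_def internal_verts_def exterior_verts_def)
  have "\<exists>n::int. \<theta> e = pi * of_int n" if "internal_edge G e" for e
    using that by (auto simp: \<theta>_def intro: exI[of _ "1::int"] exI[of _ "0::int"])
  moreover have "\<exists>n::int. \<theta> e = pi * of_int n" if "terminal_edge G e" "bc (head G e) = Dirichlet" for e
    using that disjoint by (auto simp: \<theta>_def)
  moreover have "\<exists>n::int. \<theta> e = pi / 2 + pi * of_int n"
    if "terminal_edge G e" "bc (head G e) = Neumann" for e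
    using that disjoint by (intro exI[of _ "0::int"]) (auto simp: \<theta>_def)
  ultimately have "singular_sector G bc \<theta>" by (auto simp: singular_sector_def)
  moreover have "closure_kernel G e\<^sub>0 s = bc_kernel G (parity \<theta>)"
    unfolding closure_kernel_def
    using assms by (intro bc_kernel_cong) (auto simp: parity_def \<theta>_def)
  ultimately show ?thesis by blast
qed

lemma finite_sector_parities:
  fixes G :: "('v, 'e::finite) pre_digraph"
  assumes arcs: "arcs G = UNIV"
    and edges: "\<And>e. internal_edge G e \<or> terminal_edge G e"
  shows "finite (parity ` {\<theta>. singular_sector G bc \<theta>})"
proof (rule finite_subset)
  have int: "cos (pi * of_int n) \<in> {- 1, 0, 1}" for n :: int
    by simp
  have half: "cos (pi / 2 + pi * of_int n) = 0" for n :: int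
    by (simp add: cos_add)
  have "parity \<theta> e \<in> {- 1, 0, 1}" if "singular_sector G bc \<theta>" for \<theta> e
  proof -
    have "(\<exists>n::int. \<theta> e = pi * of_int n) \<or> (\<exists>n::int. \<theta> e = pi / 2 + pi * of_int n)"
      using that edges[of e] arcs unfolding singular_sector_def
      by (cases "internal_edge G e"; cases "bc (head G e)") simp_all
    then show ?thesis unfolding parity_def using int half by fastforce
  qed
  then show "parity ` {\<theta>. singular_sector G bc \<theta>} \<subseteq> UNIV \<rightarrow>\<^sub>E {- 1, 0, 1}"
    by auto
  show "finite ((UNIV :: 'e set) \<rightarrow>\<^sub>E {- 1, 0, 1 :: real})"
    by (intro finite_PiE) auto
qed

lemma C_sing_bound:
  fixes G :: "('v, 'e::finite) pre_digraph"
  assumes arcs: "arcs G = UNIV"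
    and edges: "\<And>e. internal_edge G e \<or> terminal_edge G e"
    and len: "\<And>e. len $ e > 0" and \<alpha>: "\<And>e. \<alpha> $ e \<ge> 0"
    and sector: "singular_sector G bc \<theta>" and A: "A \<in> bc_kernel G (parity \<theta>)"
  shows "C_sing G bc \<alpha> len * (len \<bullet> hadamard_square A) \<le> \<alpha> \<bullet> hadamard_square A"
proof (cases "A = 0")
  case True
  then show ?thesis by (simp add: hadamard_square_def inner_vec_def)
next
  case False
  let ?ratio = "\<lambda>A. (\<Sum>e\<in>UNIV. \<alpha> $ e * (A $ e)\<^sup>2) / (\<Sum>e\<in>UNIV. len $ e * (A $ e)\<^sup>2)"
  let ?S = "{\<theta>. singular_sector G bc \<theta> \<and> bc_kernel G (parity \<theta>) \<noteq> {0}}"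
  have "finite (sector_value G \<alpha> len ` parity ` ?S)"
    by (rule finite_imageI, rule finite_subset[OF _ finite_sector_parities[OF arcs edges, of bc]]) auto
  moreover have "\<theta> \<in> ?S" using sector A False by auto
  ultimately have "C_sing G bc \<alpha> len \<le> sector_value G \<alpha> len (parity \<theta>)"
    unfolding C_sing_def by (intro Min_le) (auto simp: image_image)
  also have "\<dots> \<le> ?ratio A"
    unfolding sector_value_def
  proof (rule cINF_lower)
    have "0 \<le> ?ratio B" for B :: "real ^ 'e"
      using len \<alpha> by (intro divide_nonneg_nonneg sum_nonneg mult_nonneg_nonneg) (auto simp: less_imp_le)
    then show "bdd_below (?ratio ` (bc_kernel G (parity \<theta>) - {0}))" by (intro bdd_belowI2)
  qed (use A False in auto)
  finally have "C_sing G bc \<alpha> len \<le> ?ratio A" .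
  moreover have "0 < (\<Sum>e\<in>UNIV. len $ e * (A $ e)\<^sup>2)"
  proof -
    obtain e where "A $ e \<noteq> 0" using False by (auto simp: vec_eq_iff)
    then show ?thesis using len
      by (intro sum_pos2[of UNIV e]) (auto simp: less_imp_le)
  qed
  ultimately show ?thesis
    by (simp add: hadamard_square_def inner_vec_def pos_le_divide_eq)
qed

theorem theorem5p14:
  fixes G :: "('v, 'e::finite) pre_digraph"
    and bc :: "'v \<Rightarrow> boundary_condition"
    and len r :: "real ^ 'e"
    and \<theta> p q :: "'e \<Rightarrow> real"
    and \<phi> :: "'v \<Rightarrow> real"
  assumes "fin_digraph G" and "arcs G = UNIV"
    and "Digraph_Component.connected G" and "unicyclic G"
    and "\<And>e. internal_edge G e \<or> terminal_edge G e"
    and "\<And>e. len $ e > 0"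
    and "regular_secular_state G bc \<theta> \<phi> p q"
    and "r = edge_energy G \<phi> p"
  shows "r \<in> singular_cone G bc
    \<and> (\<forall>e\<^sub>0. cycle_edge G e\<^sub>0 \<longrightarrow>
        (\<exists>(Jp :: nat set) (Jm :: nat set) Ap Am.
          finite Jp \<and> finite Jm
          \<and> (\<forall>j \<in> Jp. Ap j \<in> closure_kernel G e\<^sub>0 1)
          \<and> (\<forall>j \<in> Jm. Am j \<in> closure_kernel G e\<^sub>0 (- 1))
          \<and> r = (\<Sum>j \<in> Jp. hadamard_square (Ap j)) + (\<Sum>j \<in> Jm. hadamard_square (Am j))))
    \<and> (\<forall>\<alpha> :: real ^ 'e. (\<forall>e. \<alpha> $ e \<ge> 0) \<longrightarrow> (\<alpha> \<bullet> r) / (len \<bullet> r) \<ge> C_sing G bc \<alpha> len)"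
proof -
  note arcs = assms(2) and uni = assms(4) and edges = assms(5)
    and len = assms(6) and state = assms(7) and r = assms(8)
  have decomposition: "\<exists>A\<in>closure_kernel G e 1. \<exists>B\<in>closure_kernel G e (- 1).
      r = hadamard_square A + hadamard_square B"
    if "z \<in> cycle_space G" "z $ e \<noteq> 0" for z e
    unfolding r using that by (rule edge_energy_decomposition[OF arcs uni edges state])
  have "\<not> cycle_space G \<subseteq> {0}"
    using uni by (simp add: unicyclic_def flip: dim_eq_0)
  then obtain z where "z \<in> cycle_space G" "z \<noteq> 0" by blast
  \<comment> \<open>For the cone, any edge in the support of a nonzero cycle vector can serve to close the cycle.\<close>
  then obtain e\<^sub>0 where z: "z \<in> cycle_space G" "z $ e\<^sub>0 \<noteq> 0" by (auto simp: vec_eq_iff)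
  obtain A B where A: "A \<in> closure_kernel G e\<^sub>0 1" and B: "B \<in> closure_kernel G e\<^sub>0 (- 1)"
    and AB: "r = hadamard_square A + hadamard_square B"
    using decomposition[OF z] by blast
  obtain \<theta>\<^sub>A where A': "singular_sector G bc \<theta>\<^sub>A" "A \<in> bc_kernel G (parity \<theta>\<^sub>A)"
    using closure_kernel_sector[of 1] A by (metis (no_types))
  obtain \<theta>\<^sub>B where B': "singular_sector G bc \<theta>\<^sub>B" "B \<in> bc_kernel G (parity \<theta>\<^sub>B)"
    using closure_kernel_sector[of "- 1"] B by (metis (no_types))
  have "r \<in> singular_cone G bc"
    unfolding AB singular_cone_def using A' B'
    by (intro convex_cone_hull_add hull_inc) auto
  moreover have "\<exists>(Jp :: nat set) (Jm :: nat set) Ap Am.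
          finite Jp \<and> finite Jm
          \<and> (\<forall>j \<in> Jp. Ap j \<in> closure_kernel G e\<^sub>1 1)
          \<and> (\<forall>j \<in> Jm. Am j \<in> closure_kernel G e\<^sub>1 (- 1))
          \<and> r = (\<Sum>j \<in> Jp. hadamard_square (Ap j)) + (\<Sum>j \<in> Jm. hadamard_square (Am j))"
    if "cycle_edge G e\<^sub>1" for e\<^sub>1
  proof -
    obtain y where y: "y \<in> cycle_space G" "y $ e\<^sub>1 \<noteq> 0"
      using cycle_edge_in_support[OF arcs \<open>cycle_edge G e\<^sub>1\<close>] by blast
    obtain C D where "C \<in> closure_kernel G e\<^sub>1 1" "D \<in> closure_kernel G e\<^sub>1 (- 1)"
      and "r = hadamard_square C + hadamard_square D"
      using decomposition[OF y] by blast
    then show ?thesis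
      by (intro exI[of _ "{0}"] exI[of _ "\<lambda>_. C"] exI[of _ "\<lambda>_. D"]) auto
  qed
  moreover have "C_sing G bc \<alpha> len \<le> (\<alpha> \<bullet> r) / (len \<bullet> r)"
    if \<alpha>: "\<forall>e. \<alpha> $ e \<ge> 0" for \<alpha> :: "real ^ 'e"
  proof -
    have "0 < len \<bullet> r"
    proof -
      obtain e where "r $ e \<noteq> 0"
        using edge_energy_nonzero[OF arcs edges state] r by (auto simp: vec_eq_iff)
      moreover have "0 \<le> r $ f" for f by (simp add: r edge_energy_def)
      ultimately show ?thesis
        unfolding inner_vec_def using len
        by (intro sum_pos2[of UNIV e]) (auto simp: less_imp_le less_le)
    qed
    moreover have "C_sing G bc \<alpha> len * (len \<bullet> r) \<le> \<alpha> \<bullet> r"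
      using C_sing_bound[OF arcs edges len _ A', of \<alpha>] C_sing_bound[OF arcs edges len _ B', of \<alpha>] \<alpha>
      unfolding AB by (simp add: inner_add_right distrib_left)
    ultimately show ?thesis by (simp add: pos_le_divide_eq)
  qed
  ultimately show ?thesis by blast
qed

end
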